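(* Let $G$ be a connected graph with vertex set $[n]$ and let $\mathcal{P}$ be a partition of $[n]$ that is semiequitable for $G$. Then $\mu_1(G)=\mu_1(A(G)|\mathcal{P}\times\mathcal{P})$ if and only if $\mathcal{P}$ is equitable for $G$.
   Context: Graphs are finite and simple, with vertex set $[n]=\{1,\ldots,n\}$; partitions consist of nonempty sets. $A(G)$ is the adjacency matrix of $G$ and $\mu_1(G)$ its largest eigenvalue; for a Hermitian matrix $M$, $\mu_1(M)$ is its largest eigenvalue. For disjoint vertex sets $X,Y$, $G[X]$ is the subgraph induced by $X$, and $G[X,Y]$ is the bipartite graph with vertex classes $X$ and $Y$ formed by the edges of $G$ between $X$ and $Y$. A bipartite graph is semiregular if vertices in the same vertex class have the same degree. A partition $\mathcal{P}=\{P_1,\ldots,P_k\}$ of $[n]$ is semiequitable for $G$ if $G[P_i,P_j]$ is semiregular for all $1\leq i<j\leq k$, and equitable for $G$ if, in addition, $G[P_i]$ is regular for every $i\in[k]$. For an $n\times n$ matrix $A=\{a_{ij}\}$, $A|\mathcal{P}\times\mathcal{P}$ denotes the $k\times k$ (quotient) matrix $\{b_{pq}\}$ with $$b_{pq}=\frac{1}{\sqrt{|P_p||P_q|}}\sum_{i\in P_p,\,j\in P_q}a_{ij}.$$ *)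

theory Defs
  imports
    "HOL-Library.Disjoint_Sets"
    "Graph_Theory.Digraph_Component"
    "Jordan_Normal_Form.Char_Poly"
    Complex_Main
begin

text \<open>
  A simple graph is a symmetric digraph without loops and multiple arcs
  (\<^locale>\<open>graph\<close>): an edge \<open>{u, v}\<close> is the pair of arcs \<open>(u, v)\<close> and \<open>(v, u)\<close>, so that the
  degree of a vertex is its \<^const>\<open>out_degree\<close>.
\<close>

definition regular_graph :: "('a, 'b) pre_digraph \<Rightarrow> bool" where
  "regular_graph H \<longleftrightarrow> (\<exists>d. \<forall>v \<in> verts H. out_degree H v = d)"

definition bipartite_subgraph ::
  "('a, 'b) pre_digraph \<Rightarrow> 'a set \<Rightarrow> 'a set \<Rightarrow> ('a, 'b) pre_digraph" where
  "bipartite_subgraph G X Y =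
     \<lparr> verts = X \<union> Y,
       arcs = {e \<in> arcs G. tail G e \<in> X \<and> head G e \<in> Y \<or> tail G e \<in> Y \<and> head G e \<in> X},
       tail = tail G, head = head G \<rparr>"

definition semiregular :: "'a set \<Rightarrow> 'a set \<Rightarrow> ('a, 'b) pre_digraph \<Rightarrow> bool" where
  "semiregular X Y H \<longleftrightarrow>
     (\<forall>u \<in> X. \<forall>v \<in> X. out_degree H u = out_degree H v) \<and>
     (\<forall>u \<in> Y. \<forall>v \<in> Y. out_degree H u = out_degree H v)"

text \<open>
  A partition \<open>{P\<^sub>1, \<dots>, P\<^sub>k}\<close> is given as a list of its classes, because the quotient matrix
  depends on their numbering. List and matrix positions count from 0.
\<close>

definition ordered_partition :: "'a set \<Rightarrow> 'a set list \<Rightarrow> bool" where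
  "ordered_partition V P \<longleftrightarrow> distinct P \<and> partition_on V (set P)"

definition semiequitable :: "('a, 'b) pre_digraph \<Rightarrow> 'a set list \<Rightarrow> bool" where
  "semiequitable G P \<longleftrightarrow>
     (\<forall>j < length P. \<forall>i < j. semiregular (P ! i) (P ! j) (bipartite_subgraph G (P ! i) (P ! j)))"

definition equitable :: "('a, 'b) pre_digraph \<Rightarrow> 'a set list \<Rightarrow> bool" where
  "equitable G P \<longleftrightarrow>
     semiequitable G P \<and> (\<forall>i < length P. regular_graph (G \<restriction> (P ! i)))"

text \<open>
  Vertices are numbered from 1: vertex \<open>i\<close> belongs to row and column \<open>i - 1\<close>.
\<close>

definition adjacency_matrix :: "nat \<Rightarrow> (nat, 'b) pre_digraph \<Rightarrow> complex mat" where
  "adjacency_matrix n G =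
     mat n n (\<lambda>(i, j). if (i + 1, j + 1) \<in> arcs_ends G then 1 else 0)"

definition quotient_matrix :: "complex mat \<Rightarrow> nat set list \<Rightarrow> complex mat" where
  "quotient_matrix A P =
     mat (length P) (length P) (\<lambda>(p, q).
       1 / complex_of_real (sqrt (real (card (P ! p)) * real (card (P ! q)))) *
       (\<Sum>i \<in> P ! p. \<Sum>j \<in> P ! q. A $$ (i - 1, j - 1)))"

text \<open>
  Intended for Hermitian matrices of positive dimension, whose eigenvalues form a nonempty
  finite set of real numbers.
\<close>

definition mu1 :: "complex mat \<Rightarrow> real" where
  "mu1 M = Max {x. eigenvalue M (complex_of_real x)}"

end

theory Submission
  imports Defs "HOL-Analysis.Function_Topology"
begin

text \<open>
  Let \<open>A\<close> be the adjacency matrix and \<open>B\<close> its quotient. If \<open>S\<close> has as columns the normalised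
  indicator vectors of the classes, then the columns of \<open>S\<close> are orthonormal and
  \<open>B = S\<^sup>T A S\<close>. Both matrices are real and symmetric, so each largest eigenvalue is the maximum of
  the Rayleigh quotient, and every maximiser is an eigenvector (\<open>top_eigenvalue_exists\<close>,
  \<open>maximizer_eigenfunction\<close>). Since \<open>y \<mapsto> S y\<close> preserves norm and quadratic form, always
  \<open>\<mu>\<^sub>1(B) \<le> \<mu>\<^sub>1(A)\<close> (\<open>top_eigenvalue_quotient_le\<close>).

  Suppose that the two agree. A top eigenvector \<open>y\<close> of \<open>B\<close> lifts to a maximiser \<open>x = S y\<close> for \<open>A\<close>,
  hence to a top eigenvector that is constant on classes. As \<open>A\<close> has nonnegative entries, \<open>\<bar>x\<bar>\<close> is
  a top eigenvector as well, and connectedness makes it positive everywhere. Let \<open>c\<^sub>p > 0\<close> be the value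
  of \<open>\<bar>x\<bar>\<close> on \<open>P\<^sub>p\<close>. At a vertex \<open>v \<in> P\<^sub>p\<close> the eigenvalue equation reads
  \<open>\<mu> c\<^sub>p = (\<Sum>q. deg\<^sub>q(v) c\<^sub>q)\<close>, where \<open>deg\<^sub>q(v)\<close> counts the neighbours of \<open>v\<close> in \<open>P\<^sub>q\<close>. Semiequitability makes
  all terms with \<open>q \<noteq> p\<close> independent of \<open>v\<close>, so \<open>deg\<^sub>p(v)\<close> is independent of \<open>v\<close> too.

  Conversely, for an equitable partition \<open>S\<^sup>T A = B S\<^sup>T\<close>. So \<open>S\<^sup>T\<close> maps a nonnegative top eigenvector of
  \<open>A\<close> to an eigenvector of \<open>B\<close> for the same eigenvalue; nonnegativity ensures that the image is
  not zero (\<open>class_sums_eigenfunction\<close>). Hence \<open>\<mu>\<^sub>1(A) \<le> \<mu>\<^sub>1(B)\<close>.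

  The argument is carried out for weight functions \<open>a i j\<close> on a finite index set, called kernels
  here, so that vertices and class numbers can both serve as indices; the combined statement is
  \<open>top_eigenvalue_quotient_eq_iff\<close>.
\<close>

section \<open>The largest eigenvalue of a symmetric kernel\<close>

definition quadratic_form :: "'a set \<Rightarrow> ('a \<Rightarrow> 'a \<Rightarrow> real) \<Rightarrow> ('a \<Rightarrow> real) \<Rightarrow> real" where
  "quadratic_form I a f = (\<Sum>i\<in>I. f i * (\<Sum>j\<in>I. a i j * f j))"

definition square_norm :: "'a set \<Rightarrow> ('a \<Rightarrow> real) \<Rightarrow> real" where
  "square_norm I f = (\<Sum>i\<in>I. (f i)\<^sup>2)"

definition eigenfunction :: "'a set \<Rightarrow> ('a \<Rightarrow> 'a \<Rightarrow> real) \<Rightarrow> real \<Rightarrow> ('a \<Rightarrow> real) \<Rightarrow> bool" where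
  "eigenfunction I a m f \<longleftrightarrow>
     (\<exists>i\<in>I. f i \<noteq> 0) \<and> (\<forall>i\<in>I. (\<Sum>j\<in>I. a i j * f j) = m * f i)"

text \<open>
  The second conjunct bounds the Rayleigh quotient by \<open>m\<close>; together with an eigenfunction it makes
  \<open>m\<close> both the largest eigenvalue and the maximum of that quotient.
\<close>

definition top_eigenvalue :: "'a set \<Rightarrow> ('a \<Rightarrow> 'a \<Rightarrow> real) \<Rightarrow> real \<Rightarrow> bool" where
  "top_eigenvalue I a m \<longleftrightarrow>
     (\<exists>f. eigenfunction I a m f) \<and> (\<forall>g. quadratic_form I a g \<le> m * square_norm I g)"

lemma square_norm_pos:
  assumes "finite I" "i \<in> I" "f i \<noteq> 0"
  shows "0 < square_norm I f"
  unfolding square_norm_def using assms by (intro sum_pos2[of I i]) auto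

lemma quadratic_form_eigenfunction:
  assumes "\<forall>i\<in>I. (\<Sum>j\<in>I. a i j * f j) = m * f i"
  shows "quadratic_form I a f = m * square_norm I f"
  using assms by (simp add: quadratic_form_def square_norm_def sum_distrib_left power2_eq_square mult_ac)

lemma eigenvalue_le_bound:
  assumes "finite I" "eigenfunction I a l f"
    and "quadratic_form I a f \<le> m * square_norm I f"
  shows "l \<le> m"
proof -
  obtain i where i: "i \<in> I" "f i \<noteq> 0" using assms(2) by (auto simp: eigenfunction_def)
  have "quadratic_form I a f = l * square_norm I f"
    using assms(2) by (intro quadratic_form_eigenfunction) (auto simp: eigenfunction_def)
  with assms(3) square_norm_pos[of I i f] assms(1) i show ?thesis
    by simp
qed

lemma quadratic_form_add:
  assumes sym: "\<And>i j. i \<in> I \<Longrightarrow> j \<in> I \<Longrightarrow> a i j = a j i"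
  shows "quadratic_form I a (\<lambda>i. f i + t * g i) =
    quadratic_form I a f + 2 * t * (\<Sum>i\<in>I. g i * (\<Sum>j\<in>I. a i j * f j))
      + t\<^sup>2 * quadratic_form I a g"
proof -
  have "(\<Sum>i\<in>I. f i * (\<Sum>j\<in>I. a i j * g j)) = (\<Sum>i\<in>I. \<Sum>j\<in>I. f i * (a i j * g j))"
    by (simp add: sum_distrib_left)
  also have "\<dots> = (\<Sum>j\<in>I. \<Sum>i\<in>I. f i * (a i j * g j))" by (rule sum.swap)
  also have "\<dots> = (\<Sum>i\<in>I. g i * (\<Sum>j\<in>I. a i j * f j))"
    by (auto simp: sum_distrib_left sym mult_ac intro!: sum.cong)
  finally have cross: "(\<Sum>i\<in>I. f i * (\<Sum>j\<in>I. a i j * g j)) = (\<Sum>i\<in>I. g i * (\<Sum>j\<in>I. a i j * f j))" .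
  have inner: "(\<Sum>j\<in>I. a i j * (f j + t * g j)) = (\<Sum>j\<in>I. a i j * f j) + t * (\<Sum>j\<in>I. a i j * g j)" for i
    by (simp add: algebra_simps sum.distrib sum_distrib_left)
  have "quadratic_form I a (\<lambda>i. f i + t * g i) = quadratic_form I a f
      + t * (\<Sum>i\<in>I. f i * (\<Sum>j\<in>I. a i j * g j)) + t * (\<Sum>i\<in>I. g i * (\<Sum>j\<in>I. a i j * f j))
      + t\<^sup>2 * quadratic_form I a g"
    unfolding quadratic_form_def inner
    by (simp add: algebra_simps sum.distrib sum_distrib_left power2_eq_square
)
  then show ?thesis using cross by simp
qed

lemma square_norm_add:
  "square_norm I (\<lambda>i. f i + t * g i) =
     square_norm I f + 2 * t * (\<Sum>i\<in>I. g i * f i) + t\<^sup>2 * square_norm I g"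
  by (simp add: square_norm_def power2_eq_square algebra_simps sum.distrib sum_distrib_left)

text \<open>
  First variation: if the residual \<open>r = a f - m f\<close> did not vanish, moving from \<open>f\<close> a little in
  the direction \<open>r\<close> would raise \<open>quadratic_form - m * square_norm\<close> above its maximum \<open>0\<close>.
\<close>

lemma maximizer_eigen_equation:
  assumes fin: "finite I"
    and sym: "\<And>i j. i \<in> I \<Longrightarrow> j \<in> I \<Longrightarrow> a i j = a j i"
    and bound: "\<And>g. quadratic_form I a g \<le> m * square_norm I g"
    and eq: "quadratic_form I a f = m * square_norm I f"
  shows "\<forall>i\<in>I. (\<Sum>j\<in>I. a i j * f j) = m * f i"
proof -
  define r where "r i = (\<Sum>j\<in>I. a i j * f j) - m * f i" for i
  define R where "R = square_norm I r"
  define C where "C = m * square_norm I r - quadratic_form I a r"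
  have R: "R = (\<Sum>i\<in>I. r i * (\<Sum>j\<in>I. a i j * f j)) - m * (\<Sum>i\<in>I. r i * f i)"
  proof -
    have "(r i)\<^sup>2 = r i * (\<Sum>j\<in>I. a i j * f j) - m * (r i * f i)" for i
    proof -
      have "(r i)\<^sup>2 = r i * ((\<Sum>j\<in>I. a i j * f j) - m * f i)"
        by (simp only: power2_eq_square r_def)
      then show ?thesis by (simp only: right_diff_distrib mult.left_commute)
    qed
    then show ?thesis
      by (simp only: R_def square_norm_def sum_subtractf sum_distrib_left)
  qed
  have C0: "0 \<le> C" using bound[of r] by (simp add: C_def)
  have ineq: "2 * t * R \<le> t\<^sup>2 * C" for t
  proof -
    have "m * square_norm I f + 2 * t * (\<Sum>i\<in>I. r i * (\<Sum>j\<in>I. a i j * f j)) + t\<^sup>2 * quadratic_form I a r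
      \<le> m * (square_norm I f + 2 * t * (\<Sum>i\<in>I. r i * f i) + t\<^sup>2 * square_norm I r)"
      using bound[of "\<lambda>i. f i + t * r i"]
      by (simp only: quadratic_form_add[OF sym] square_norm_add eq)
    then show ?thesis unfolding R C_def by argo
  qed
  have "R \<le> 0"
  proof (rule ccontr)
    assume "\<not> R \<le> 0"
    then have "0 < R" by simp
    \<comment> \<open>Small enough for the linear term to beat the quadratic one; \<open>+ 1\<close> covers \<open>C = 0\<close>.\<close>
    define t where "t = R / (C + 1)"
    have "0 < t" using \<open>0 < R\<close> C0 by (simp add: t_def)
    have "t * (2 * R) \<le> t * (t * C)" using ineq[of t] by (simp add: power2_eq_square mult_ac)
    then have "2 * R \<le> t * C" using \<open>0 < t\<close> by simp
    also have "t * C \<le> t * (C + 1)" using \<open>0 < t\<close> by simp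
    also have "\<dots> = R" using C0 by (simp add: t_def)
    finally show False using \<open>0 < R\<close> by simp
  qed
  then have "r i = 0" if "i \<in> I" for i
    using square_norm_pos[of I i r] fin that by (auto simp: R_def)
  then show ?thesis by (simp add: r_def)
qed

text \<open>
  The quadratic form attains its maximum on the unit sphere, which is compact. Functions are
  made to vanish outside \<open>I\<close>, so that the sphere lies in a product of compact sets.
\<close>

lemma top_eigenvalue_exists:
  fixes a :: "'a \<Rightarrow> 'a \<Rightarrow> real"
  assumes fin: "finite I" and ne: "I \<noteq> {}"
    and sym: "\<And>i j. i \<in> I \<Longrightarrow> j \<in> I \<Longrightarrow> a i j = a j i"
  shows "\<exists>m. top_eigenvalue I a m"
proof -
  define K :: "('a \<Rightarrow> real) set" where
    "K = (PiE UNIV (\<lambda>i. if i \<in> I then {-1..1} else {0}))"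
  define S where "S = K \<inter> {f. square_norm I f = 1}"
  have cont_coord: "continuous_on UNIV (\<lambda>f::'a \<Rightarrow> real. f i)" for i
    by simp
  have "compactin (product_topology (\<lambda>i. euclidean) UNIV) K"
    unfolding K_def by (subst compactin_PiE) auto
  then have "compact K"
    by (simp add: euclidean_product_topology)
  moreover have "closed {f::'a \<Rightarrow> real. square_norm I f = 1}"
    unfolding square_norm_def
    by (intro closed_Collect_eq continuous_intros cont_coord)
  ultimately have "compact S" unfolding S_def by (rule compact_Int_closed)
  have cont: "continuous_on S (quadratic_form I a)"
    unfolding quadratic_form_def[abs_def]
    by (rule continuous_on_subset[OF _ subset_UNIV]) (intro continuous_intros cont_coord)
  obtain i where i: "i \<in> I" using ne by auto
  have "square_norm I (\<lambda>j. if j = i then 1 else 0) = (\<Sum>j\<in>I. if j = i then 1 else 0)"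
    unfolding square_norm_def by (intro sum.cong) auto
  then have "(\<lambda>j. if j = i then 1 else 0) \<in> S"
    using i fin by (auto simp: S_def K_def)
  then have "S \<noteq> {}" by auto
  then obtain f where f: "f \<in> S" and max: "\<forall>g\<in>S. quadratic_form I a g \<le> quadratic_form I a f"
    using continuous_attains_sup[OF \<open>compact S\<close> _ cont] by blast
  define m where "m = quadratic_form I a f"
  have bound: "quadratic_form I a g \<le> m * square_norm I g" for g
  proof (cases "\<exists>i\<in>I. g i \<noteq> 0")
    case False
    then show ?thesis by (simp add: quadratic_form_def square_norm_def)
  next
    case True
    then have N: "0 < square_norm I g" using square_norm_pos[OF fin] by blast
    define s where "s = sqrt (square_norm I g)"
    have s: "0 < s" "s\<^sup>2 = square_norm I g" using N by (auto simp: s_def)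
    define h where "h i = (if i \<in> I then g i / s else 0)" for i
    have "square_norm I h = square_norm I g / s\<^sup>2"
      by (simp add: square_norm_def h_def power_divide sum_divide_distrib)
    then have h1: "square_norm I h = 1" using s N by simp
    have "(h i)\<^sup>2 \<le> 1" if "i \<in> I" for i
      unfolding h1[symmetric] square_norm_def using that fin by (intro member_le_sum) auto
    then have "\<bar>h i\<bar> \<le> 1" if "i \<in> I" for i using that by (simp add: abs_square_le_1)
    moreover have "h i = 0" if "i \<notin> I" for i using that by (simp add: h_def)
    ultimately have "h \<in> K" by (force simp: K_def abs_le_iff)
    then have "h \<in> S" using h1 by (simp add: S_def)
    then have "quadratic_form I a h \<le> m" using max by (simp add: m_def)
    moreover have "quadratic_form I a h = quadratic_form I a g / s\<^sup>2"
      by (simp add: quadratic_form_def h_def sum_divide_distrib[symmetric] power2_eq_square)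
    ultimately show ?thesis using s N by (simp add: field_simps)
  qed
  have f1: "square_norm I f = 1" using f by (simp add: S_def)
  have "\<exists>i\<in>I. f i \<noteq> 0"
    using f1 by (auto simp: square_norm_def intro: ccontr)
  moreover have "\<forall>i\<in>I. (\<Sum>j\<in>I. a i j * f j) = m * f i"
    by (rule maximizer_eigen_equation[OF fin sym bound]) (simp_all add: f1 m_def)
  ultimately show ?thesis
    using bound by (auto simp: top_eigenvalue_def eigenfunction_def)
qed

text \<open>
  The form in which maximisers are used: it is enough to reach the maximal Rayleigh quotient.
\<close>

lemma maximizer_eigenfunction:
  assumes "finite I" "\<And>i j. i \<in> I \<Longrightarrow> j \<in> I \<Longrightarrow> a i j = a j i" "top_eigenvalue I a m"
    and "m * square_norm I f \<le> quadratic_form I a f" "\<exists>i\<in>I. f i \<noteq> 0"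
  shows "eigenfunction I a m f"
proof -
  have b: "\<And>g. quadratic_form I a g \<le> m * square_norm I g"
    using assms(3) by (simp add: top_eigenvalue_def)
  have "quadratic_form I a f = m * square_norm I f" using b[of f] assms(4) by simp
  with maximizer_eigen_equation[of I a m f] assms b show ?thesis
    by (simp add: eigenfunction_def)
qed

section \<open>Perron vectors\<close>

text \<open>
  Passing to absolute values keeps the norm and, for nonnegative weights, cannot decrease the
  quadratic form; so \<open>\<bar>f\<bar>\<close> is again a maximiser.
\<close>

lemma abs_top_eigenfunction:
  assumes fin: "finite I" and sym: "\<And>i j. i \<in> I \<Longrightarrow> j \<in> I \<Longrightarrow> a i j = a j i"
    and nonneg: "\<And>i j. i \<in> I \<Longrightarrow> j \<in> I \<Longrightarrow> 0 \<le> a i j"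
    and top: "top_eigenvalue I a m" and f: "eigenfunction I a m f"
  shows "eigenfunction I a m (\<lambda>i. \<bar>f i\<bar>)"
proof (rule maximizer_eigenfunction[OF fin sym top])
  have "m * square_norm I (\<lambda>i. \<bar>f i\<bar>) = m * square_norm I f"
    by (simp add: square_norm_def)
  also have "\<dots> = quadratic_form I a f"
    using f by (intro quadratic_form_eigenfunction[symmetric]) (simp add: eigenfunction_def)
  also have "\<dots> \<le> quadratic_form I a (\<lambda>i. \<bar>f i\<bar>)"
    unfolding quadratic_form_def sum_distrib_left
  proof (intro sum_mono)
    fix i j assume "i \<in> I" "j \<in> I"
    then have "f i * (a i j * f j) \<le> \<bar>f i * (a i j * f j)\<bar>" by simp
    also have "\<dots> = \<bar>f i\<bar> * (a i j * \<bar>f j\<bar>)"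
      using nonneg[OF \<open>i \<in> I\<close> \<open>j \<in> I\<close>] by (simp add: abs_mult)
    finally show "f i * (a i j * f j) \<le> \<bar>f i\<bar> * (a i j * \<bar>f j\<bar>)" .
  qed
  finally show "m * square_norm I (\<lambda>i. \<bar>f i\<bar>) \<le> quadratic_form I a (\<lambda>i. \<bar>f i\<bar>)" .
  show "\<exists>i\<in>I. \<bar>f i\<bar> \<noteq> 0" using f by (simp add: eigenfunction_def)
qed

text \<open>
  The support of a nonnegative eigenfunction is closed under adjacency: a neighbour \<open>j\<close> of a vertex
  of the support receives a positive contribution in \<open>m * f j\<close>. The hypothesis \<open>irred\<close> is
  irreducibility, expressed by the absence of proper nonempty closed sets.
\<close>

lemma nonneg_eigenfunction_pos:
  assumes fin: "finite I"
    and sym: "\<And>i j. i \<in> I \<Longrightarrow> j \<in> I \<Longrightarrow> a i j = a j i"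
    and nonneg: "\<And>i j. i \<in> I \<Longrightarrow> j \<in> I \<Longrightarrow> 0 \<le> a i j"
    and irred: "\<And>S. S \<subseteq> I \<Longrightarrow> S \<noteq> {} \<Longrightarrow>
      (\<And>i j. i \<in> S \<Longrightarrow> j \<in> I \<Longrightarrow> 0 < a i j \<Longrightarrow> j \<in> S) \<Longrightarrow> S = I"
    and f: "eigenfunction I a m f" and f0: "\<And>i. i \<in> I \<Longrightarrow> 0 \<le> f i"
    and "i \<in> I"
  shows "0 < f i"
proof -
  have "{i \<in> I. 0 < f i} = I"
  proof (rule irred)
    show "{i \<in> I. 0 < f i} \<noteq> {}" 
      using f f0 by (force simp: eigenfunction_def less_le)
    fix i j assume i: "i \<in> {i \<in> I. 0 < f i}" and j: "j \<in> I" and a: "0 < a i j"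
    have "0 < a j i * f i" using i j a sym[of i j] by simp
    also have "\<dots> \<le> (\<Sum>k\<in>I. a j k * f k)"
      using i j fin nonneg f0 by (intro member_le_sum) auto
    also have "\<dots> = m * f j" using f j by (simp add: eigenfunction_def)
    finally have "f j \<noteq> 0" by auto
    then show "j \<in> {i \<in> I. 0 < f i}" using f0[OF j] j by (simp add: less_le)
  qed auto
  then show ?thesis using \<open>i \<in> I\<close> by auto
qed

section \<open>The largest eigenvalue of a matrix\<close>

text \<open>
  For a real matrix and a real eigenvalue, the real and the imaginary part of a complex eigenvector
  both satisfy the eigenvalue equation, and one of them is nonzero. The bijection \<open>e\<close> translates
  matrix positions, which count from 0, into indices of the kernel.
\<close>

lemma eigenvalue_mat_iff:
  assumes e: "bij_betw e {..<n} I"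
    and M: "M = mat n n (\<lambda>(i, j). complex_of_real (a (e i) (e j)))"
  shows "eigenvalue M (complex_of_real l) \<longleftrightarrow> (\<exists>f. eigenfunction I a l f)"
proof
  have reindex: "(\<Sum>j<n. h (e j)) = (\<Sum>j\<in>I. h j)" for h :: "'a \<Rightarrow> real"
    using e by (rule sum.reindex_bij_betw)
  have dimM: "dim_row M = n" "dim_col M = n" by (simp_all add: M)
  have mult: "(M *\<^sub>v v) $ i = (\<Sum>j<n. complex_of_real (a (e i) (e j)) * v $ j)"
    if "i < n" "v \<in> carrier_vec n" for i v
    using that by (simp add: M scalar_prod_def atLeast0LessThan)
  have inv: "inv_into {..<n} e (e i) = i" if "i < n" for i
    using e that by (simp add: bij_betw_def inv_into_f_f)
  {
    assume "eigenvalue M (complex_of_real l)"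
    then obtain v where v: "v \<in> carrier_vec n" "v \<noteq> 0\<^sub>v n" "M *\<^sub>v v = complex_of_real l \<cdot>\<^sub>v v"
      by (auto simp: eigenvalue_def eigenvector_def dimM)
    have eqn: "(\<Sum>j<n. complex_of_real (a (e i) (e j)) * v $ j) = complex_of_real l * v $ i" if "i < n" for i
      using mult[OF that v(1)] v that by simp
    have part: "\<exists>f. eigenfunction I a l f"
      if w: "\<And>i. i < n \<Longrightarrow> (\<Sum>j<n. a (e i) (e j) * w j) = l * w i" and "i < n" "w i \<noteq> 0"
      for w :: "nat \<Rightarrow> real" and i
    proof (intro exI[of _ "\<lambda>x. w (inv_into {..<n} e x)"])
      have "(\<Sum>j\<in>I. a (e i) j * w (inv_into {..<n} e j)) = l * w (inv_into {..<n} e (e i))" if "i < n" for i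
        using w[OF that] by (simp add: reindex[symmetric] inv that)
      then show "eigenfunction I a l (\<lambda>x. w (inv_into {..<n} e x))"
        unfolding eigenfunction_def bij_betw_imp_surj_on[OF e, symmetric]
        using that inv by auto
    qed
    obtain i where i: "i < n" "v $ i \<noteq> 0" using v(1,2) by (metis carrier_vecD eq_vecI index_zero_vec)
    show "\<exists>f. eigenfunction I a l f"
    proof (cases "Re (v $ i) = 0")
      case True
      then have "Im (v $ i) \<noteq> 0" using i by (simp add: complex_eq_iff)
      moreover have "(\<Sum>j<n. a (e i) (e j) * Im (v $ j)) = l * Im (v $ i)" if "i < n" for i
        using arg_cong[OF eqn[OF that], of Im] by simp
      ultimately show ?thesis using part[of "\<lambda>i. Im (v $ i)"] i by blast
    next
      case False
      moreover have "(\<Sum>j<n. a (e i) (e j) * Re (v $ j)) = l * Re (v $ i)" if "i < n" for i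
        using arg_cong[OF eqn[OF that], of Re] by simp
      ultimately show ?thesis using part[of "\<lambda>i. Re (v $ i)"] i by blast
    qed
  }
  assume "\<exists>f. eigenfunction I a l f"
  then obtain f where f: "eigenfunction I a l f" ..
  define v where "v = vec n (\<lambda>i. complex_of_real (f (e i)))"
  have v: "v \<in> carrier_vec n" by (simp add: v_def)
  obtain i where "i < n" "f (e i) \<noteq> 0"
    using f e by (auto simp: eigenfunction_def bij_betw_def)
  then have "v \<noteq> 0\<^sub>v n" by (auto simp: v_def dest!: arg_cong[of _ _ "\<lambda>v. v $ i"])
  moreover have "M *\<^sub>v v = complex_of_real l \<cdot>\<^sub>v v"
  proof (rule eq_vecI)
    show "dim_vec (M *\<^sub>v v) = dim_vec (complex_of_real l \<cdot>\<^sub>v v)" by (simp add: dimM v_def)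
    fix i assume "i < dim_vec (complex_of_real l \<cdot>\<^sub>v v)"
    then have i: "i < n" by (simp add: v_def)
    have "e i \<in> I" using i e by (auto simp: bij_betw_def)
    have "(M *\<^sub>v v) $ i = complex_of_real (\<Sum>j<n. a (e i) (e j) * f (e j))"
      using mult[OF i v] by (simp add: v_def)
    also have "(\<Sum>j<n. a (e i) (e j) * f (e j)) = l * f (e i)"
      using f \<open>e i \<in> I\<close> by (simp add: reindex[of "\<lambda>j. a (e i) j * f j"] eigenfunction_def)
    finally show "(M *\<^sub>v v) $ i = (complex_of_real l \<cdot>\<^sub>v v) $ i" using i by (simp add: v_def)
  qed
  ultimately show "eigenvalue M (complex_of_real l)"
    using v by (auto simp: eigenvalue_def eigenvector_def dimM)
qed

text \<open>
  Finiteness of the spectrum has to be checked because \<^const>\<open>Max\<close> is meaningful only on finite sets.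
\<close>

lemma mu1_eq_top_eigenvalue:
  assumes e: "bij_betw e {..<n} I"
    and M: "M = mat n n (\<lambda>(i, j). complex_of_real (a (e i) (e j)))"
    and top: "top_eigenvalue I a m"
  shows "mu1 M = m"
proof -
  have fin: "finite I" using e bij_betw_finite by blast
  have carrier: "M \<in> carrier_mat n n" by (simp add: M)
  have "char_poly M \<noteq> 0" using degree_monic_char_poly[OF carrier] by auto
  then have "finite {z. poly (char_poly M) z = 0}" by (rule poly_roots_finite)
  then have "finite {z. eigenvalue M z}" using eigenvalue_root_char_poly[OF carrier] by simp
  then have "finite (complex_of_real -` {z. eigenvalue M z})"
    by (rule finite_vimageI) (simp add: inj_on_def)
  then have "finite {x. eigenvalue M (complex_of_real x)}" by (simp add: vimage_def)
  then show ?thesis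
    unfolding mu1_def
  proof (rule Max_eqI)
    fix l assume "l \<in> {x. eigenvalue M (complex_of_real x)}"
    then obtain f where "eigenfunction I a l f" using eigenvalue_mat_iff[OF e M] by auto
    then show "l \<le> m"
      using eigenvalue_le_bound[OF fin] top by (auto simp: top_eigenvalue_def)
  next
    show "m \<in> {x. eigenvalue M (complex_of_real x)}"
      using top eigenvalue_mat_iff[OF e M] by (auto simp: top_eigenvalue_def)
  qed
qed

section \<open>Quotients of kernels\<close>

definition quotient_kernel :: "('a \<Rightarrow> 'a \<Rightarrow> real) \<Rightarrow> 'a set list \<Rightarrow> nat \<Rightarrow> nat \<Rightarrow> real" where
  "quotient_kernel a P p q =
     (\<Sum>u\<in>P ! p. \<Sum>v\<in>P ! q. a u v) / (sqrt (card (P ! p)) * sqrt (card (P ! q)))"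

text \<open>Determined for every vertex that lies in some class, because distinct classes are disjoint.\<close>

definition class_index :: "'a set list \<Rightarrow> 'a \<Rightarrow> nat" where
  "class_index P v = (SOME p. p < length P \<and> v \<in> P ! p)"

text \<open>
  Multiplication by the matrix whose columns are the normalised indicator vectors of the classes.
\<close>

definition lift :: "'a set list \<Rightarrow> (nat \<Rightarrow> real) \<Rightarrow> 'a \<Rightarrow> real" where
  "lift P y v = y (class_index P v) / sqrt (card (P ! class_index P v))"

lemma ordered_partition_disjoint:
  assumes "ordered_partition V P" "p < length P" "q < length P" "p \<noteq> q"
  shows "P ! p \<inter> P ! q = {}"
  using assms unfolding ordered_partition_def partition_on_def
  by (meson disjointD nth_eq_iff_index_eq nth_mem)

lemma ordered_partition_subset:
  assumes "ordered_partition V P" "p < length P"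
  shows "P ! p \<subseteq> V"
  using assms unfolding ordered_partition_def partition_on_def by auto

lemma ordered_partition_nonempty:
  assumes "ordered_partition V P" "p < length P"
  shows "P ! p \<noteq> {}"
  using assms by (metis nth_mem ordered_partition_def partition_on_def)

lemma ordered_partition_card_pos:
  assumes "finite V" "ordered_partition V P" "p < length P"
  shows "0 < card (P ! p)"
proof -
  have "P ! p \<noteq> {}" using ordered_partition_nonempty[OF assms(2,3)] .
  moreover have "finite (P ! p)"
    using assms ordered_partition_subset finite_subset by metis
  ultimately show ?thesis by (simp add: card_gt_0_iff)
qed

lemma ordered_partition_cover:
  assumes "ordered_partition V P" "v \<in> V"
  obtains p where "p < length P" "v \<in> P ! p"
proof -
  have "v \<in> \<Union>(set P)" using assms by (simp add: ordered_partition_def partition_on_def)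
  then show ?thesis using that by (auto simp: in_set_conv_nth)
qed

lemma class_index_eq:
  assumes "ordered_partition V P" "p < length P" "v \<in> P ! p"
  shows "class_index P v = p"
  unfolding class_index_def
proof (rule some_equality)
  fix q assume "q < length P \<and> v \<in> P ! q"
  then show "q = p" using ordered_partition_disjoint[OF assms(1,2)] assms(3) by blast
qed (use assms in auto)

lemma lift_eq:
  assumes "ordered_partition V P" "p < length P" "v \<in> P ! p"
  shows "lift P y v = y p / sqrt (card (P ! p))"
  using class_index_eq[OF assms] by (simp add: lift_def)

lemma sum_over_classes:
  fixes h :: "'a \<Rightarrow> real"
  assumes "finite V" "ordered_partition V P"
  shows "(\<Sum>v\<in>V. h v) = (\<Sum>p<length P. \<Sum>v\<in>P ! p. h v)"
proof -
  have "V = (\<Union>p<length P. P ! p)"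
  proof
    show "V \<subseteq> (\<Union>p<length P. P ! p)"
      by (rule subsetI, erule ordered_partition_cover[OF assms(2)]) blast
    show "(\<Union>p<length P. P ! p) \<subseteq> V"
      using ordered_partition_subset[OF assms(2)] by (intro UN_least) simp
  qed
  then have "(\<Sum>v\<in>V. h v) = sum h (\<Union>p\<in>{..<length P}. P ! p)" by (rule arg_cong)
  also have "\<dots> = (\<Sum>p<length P. \<Sum>v\<in>P ! p. h v)"
    using assms(1) ordered_partition_disjoint[OF assms(2)] ordered_partition_subset[OF assms(2)]
    by (intro sum.UNION_disjoint) (simp_all add: finite_subset[OF _ assms(1)])
  finally show ?thesis .
qed

text \<open>
  The next two lemmas express \<open>S\<^sup>T S = 1\<close> and \<open>S\<^sup>T A S = B\<close>.
\<close>

lemma square_norm_lift: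
  assumes "finite V" "ordered_partition V P"
  shows "square_norm V (lift P y) = square_norm {..<length P} y"
proof -
  have "(\<Sum>v\<in>P ! p. (lift P y v)\<^sup>2) = (y p)\<^sup>2" if "p < length P" for p
    using lift_eq[OF assms(2) that] ordered_partition_card_pos[OF assms that]
    by (simp add: power_divide)
  then show ?thesis
    by (simp add: square_norm_def sum_over_classes[OF assms])
qed

lemma quadratic_form_lift:
  assumes "finite V" "ordered_partition V P"
  shows "quadratic_form V a (lift P y) = quadratic_form {..<length P} (quotient_kernel a P) y"
proof -
  have blk: "(\<Sum>u\<in>P ! p. \<Sum>v\<in>P ! q. lift P y u * (a u v * lift P y v)) = y p * (quotient_kernel a P p q * y q)"
    if "p < length P" "q < length P" for p q
  proof -
    have "(\<Sum>u\<in>P ! p. \<Sum>v\<in>P ! q. lift P y u * (a u v * lift P y v))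
      = (\<Sum>u\<in>P ! p. \<Sum>v\<in>P ! q. y p / sqrt (card (P ! p)) * (y q / sqrt (card (P ! q))) * a u v)"
      using that by (intro sum.cong refl) (simp add: lift_eq[OF assms(2)])
    also have "\<dots> = y p / sqrt (card (P ! p)) * (y q / sqrt (card (P ! q))) * (\<Sum>u\<in>P ! p. \<Sum>v\<in>P ! q. a u v)"
      by (simp only: sum_distrib_left)
    finally show ?thesis by (simp add: quotient_kernel_def)
  qed
  have "quadratic_form V a (lift P y) = (\<Sum>p<length P. \<Sum>u\<in>P ! p. \<Sum>q<length P. \<Sum>v\<in>P ! q. lift P y u * (a u v * lift P y v))"
    by (simp only: quadratic_form_def sum_over_classes[OF assms] sum_distrib_left)
  also have "\<dots> = (\<Sum>p<length P. \<Sum>q<length P. \<Sum>u\<in>P ! p. \<Sum>v\<in>P ! q. lift P y u * (a u v * lift P y v))"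
    by (rule sum.cong[OF refl]) (rule sum.swap)
  also have "\<dots> = quadratic_form {..<length P} (quotient_kernel a P) y"
    by (simp add: blk quadratic_form_def sum_distrib_left)
  finally show ?thesis .
qed

lemma quotient_kernel_sym:
  assumes op: "ordered_partition V P" and sym: "\<And>u v. u \<in> V \<Longrightarrow> v \<in> V \<Longrightarrow> a u v = a v u"
    and "p < length P" "q < length P"
  shows "quotient_kernel a P p q = quotient_kernel a P q p"
proof -
  have "(\<Sum>u\<in>P ! p. \<Sum>v\<in>P ! q. a u v) = (\<Sum>u\<in>P ! p. \<Sum>v\<in>P ! q. a v u)"
    using assms ordered_partition_subset[OF op] by (intro sum.cong refl sym) blast+
  also have "\<dots> = (\<Sum>v\<in>P ! q. \<Sum>u\<in>P ! p. a v u)" by (rule sum.swap)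
  finally show ?thesis by (simp add: quotient_kernel_def mult_ac)
qed

lemma top_eigenvalue_quotient_le:
  assumes fin: "finite V" and op: "ordered_partition V P"
    and A: "top_eigenvalue V a m" and B: "top_eigenvalue {..<length P} (quotient_kernel a P) l"
  shows "l \<le> m"
proof -
  obtain y where "eigenfunction {..<length P} (quotient_kernel a P) l y"
    using B by (auto simp: top_eigenvalue_def)
  moreover have "quadratic_form V a (lift P y) \<le> m * square_norm V (lift P y)"
    using A by (simp add: top_eigenvalue_def)
  ultimately show ?thesis
    using eigenvalue_le_bound[of "{..<length P}"]
    by (simp add: quadratic_form_lift[OF fin op] square_norm_lift[OF fin op])
qed

text \<open>
  The transpose of \<open>lift\<close> intertwines the kernel with its quotient when every vertex of a class
  sends the same total weight \<open>d\<close> to any given class. Double counting the weight between two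
  classes \<open>p\<close> and \<open>q\<close> lets each entry of the quotient be computed from the side of \<open>q\<close>, where the
  sums of \<open>h\<close> are taken.
\<close>

lemma class_sums_eigenfunction:
  assumes fin: "finite V" and op: "ordered_partition V P"
    and sym: "\<And>u v. u \<in> V \<Longrightarrow> v \<in> V \<Longrightarrow> a u v = a v u"
    and const: "\<And>p q u v. p < length P \<Longrightarrow> q < length P \<Longrightarrow> u \<in> P ! p \<Longrightarrow> v \<in> P ! p \<Longrightarrow>
      (\<Sum>w\<in>P ! q. a u w) = (\<Sum>w\<in>P ! q. a v w)"
    and h: "eigenfunction V a m h" and h0: "\<And>v. v \<in> V \<Longrightarrow> 0 \<le> h v"
  shows "eigenfunction {..<length P} (quotient_kernel a P) m
    (\<lambda>p. (\<Sum>v\<in>P ! p. h v) / sqrt (card (P ! p)))"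
proof -
  let ?k = "length P"
  let ?s = "\<lambda>p. sqrt (card (P ! p))"
  have sub: "P ! p \<subseteq> V" if "p < ?k" for p using ordered_partition_subset[OF op that] .
  have card: "0 < card (P ! p)" if "p < ?k" for p
    using ordered_partition_card_pos[OF fin op that] .
  have eqn: "(\<Sum>q<?k. quotient_kernel a P p q * ((\<Sum>v\<in>P ! q. h v) / ?s q)) = m * ((\<Sum>v\<in>P ! p. h v) / ?s p)"
    if p: "p < ?k" for p
  proof -
    have blk: "quotient_kernel a P p q * ((\<Sum>v\<in>P ! q. h v) / ?s q)
      = (\<Sum>w\<in>P ! q. \<Sum>v\<in>P ! p. a v w * h w) / ?s p" if q: "q < ?k" for q
    proof -
      obtain w0 where w0: "w0 \<in> P ! q" using ordered_partition_nonempty[OF op q] by auto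
      define d where "d = (\<Sum>v\<in>P ! p. a w0 v)"
      have d: "(\<Sum>v\<in>P ! p. a w v) = d" if "w \<in> P ! q" for w
        using const[OF q p that w0] by (simp add: d_def)
      have "(\<Sum>u\<in>P ! p. \<Sum>v\<in>P ! q. a u v) = (\<Sum>w\<in>P ! q. \<Sum>v\<in>P ! p. a v w)" by (rule sum.swap)
      also have "\<dots> = (\<Sum>w\<in>P ! q. \<Sum>v\<in>P ! p. a w v)"
        using sub[OF p] sub[OF q] by (intro sum.cong refl sym) blast+
      also have "\<dots> = card (P ! q) * d" by (simp add: d)
      finally have b: "quotient_kernel a P p q = card (P ! q) * d / (?s p * ?s q)"
        by (simp add: quotient_kernel_def)
      have "(\<Sum>w\<in>P ! q. \<Sum>v\<in>P ! p. a v w * h w) = (\<Sum>w\<in>P ! q. (\<Sum>v\<in>P ! p. a w v) * h w)"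
        unfolding sum_distrib_right
        using sub[OF p] sub[OF q] by (intro sum.cong refl arg_cong2[where f="(*)"] sym) blast+
      also have "\<dots> = d * (\<Sum>w\<in>P ! q. h w)" by (simp add: d sum_distrib_left)
      finally have e: "(\<Sum>w\<in>P ! q. \<Sum>v\<in>P ! p. a v w * h w) = d * (\<Sum>w\<in>P ! q. h w)" .
      have "card (P ! q) * d / (?s p * ?s q) = card (P ! q) / ?s q * d / ?s p"
        by (simp only: divide_inverse inverse_mult_distrib mult_ac)
      also have "card (P ! q) / ?s q = ?s q" by (simp add: real_div_sqrt)
      finally have "quotient_kernel a P p q = ?s q * d / ?s p" unfolding b .
      moreover have "?s q \<noteq> 0" using card[OF q] by simp
      ultimately show ?thesis unfolding e by simp
    qed
    have "(\<Sum>q<?k. quotient_kernel a P p q * ((\<Sum>v\<in>P ! q. h v) / ?s q))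
      = (\<Sum>q<?k. \<Sum>w\<in>P ! q. \<Sum>v\<in>P ! p. a v w * h w) / ?s p"
      unfolding sum_divide_distrib[of _ "{..<?k}"] by (rule sum.cong[OF refl], rule blk) simp
    also have "\<dots> = (\<Sum>w\<in>V. \<Sum>v\<in>P ! p. a v w * h w) / ?s p"
      by (simp only: sum_over_classes[OF fin op])
    also have "\<dots> = (\<Sum>v\<in>P ! p. \<Sum>w\<in>V. a v w * h w) / ?s p"
      by (subst sum.swap) simp
    also have "(\<Sum>v\<in>P ! p. \<Sum>w\<in>V. a v w * h w) = m * (\<Sum>v\<in>P ! p. h v)"
      using h sub[OF p] by (auto simp: eigenfunction_def sum_distrib_left intro!: sum.cong)
    finally show ?thesis by simp
  qed
  obtain v where v: "v \<in> V" "h v \<noteq> 0" using h by (auto simp: eigenfunction_def)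
  obtain p where p: "p < ?k" "v \<in> P ! p" using ordered_partition_cover[OF op v(1)] .
  have "0 < h v" using h0[OF v(1)] v(2) by simp
  then have "0 < (\<Sum>v\<in>P ! p. h v)"
    using p sub[OF p(1)] h0 finite_subset[OF sub[OF p(1)] fin] by (intro sum_pos2[of _ v]) auto
  then have "(\<Sum>v\<in>P ! p. h v) / ?s p \<noteq> 0" using card[OF p(1)] by simp
  with eqn p(1) show ?thesis unfolding eigenfunction_def by blast
qed

text \<open>
  For equal top eigenvalues the lifted maximiser gives a positive eigenfunction with constant
  value \<open>c p\<close> on each class. Solving its eigenvalue equation for the weight that a vertex sends into
  its own class expresses that weight by quantities depending on the class only (\<open>split\<close>).
\<close>

theorem top_eigenvalue_quotient_eq_iff:
  assumes fin: "finite V" and op: "ordered_partition V P"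
    and sym: "\<And>u v. u \<in> V \<Longrightarrow> v \<in> V \<Longrightarrow> a u v = a v u"
    and nonneg: "\<And>u v. u \<in> V \<Longrightarrow> v \<in> V \<Longrightarrow> 0 \<le> a u v"
    and irred: "\<And>S. S \<subseteq> V \<Longrightarrow> S \<noteq> {} \<Longrightarrow>
      (\<And>u v. u \<in> S \<Longrightarrow> v \<in> V \<Longrightarrow> 0 < a u v \<Longrightarrow> v \<in> S) \<Longrightarrow> S = V"
    and semi: "\<And>p q u v. p < length P \<Longrightarrow> q < length P \<Longrightarrow> p \<noteq> q \<Longrightarrow> u \<in> P ! p \<Longrightarrow> v \<in> P ! p \<Longrightarrow>
      (\<Sum>w\<in>P ! q. a u w) = (\<Sum>w\<in>P ! q. a v w)"
    and A: "top_eigenvalue V a m" and B: "top_eigenvalue {..<length P} (quotient_kernel a P) l"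
  shows "m = l \<longleftrightarrow>
    (\<forall>p<length P. \<forall>u\<in>P ! p. \<forall>v\<in>P ! p. (\<Sum>w\<in>P ! p. a u w) = (\<Sum>w\<in>P ! p. a v w))"
proof
  let ?k = "length P"
  have sub: "P ! p \<subseteq> V" if "p < ?k" for p using ordered_partition_subset[OF op that] .
  have card: "0 < card (P ! p)" if "p < ?k" for p
    using ordered_partition_card_pos[OF fin op that] .
  {
    assume "m = l"
    obtain y where y: "eigenfunction {..<?k} (quotient_kernel a P) m y"
      using B \<open>m = l\<close> by (auto simp: top_eigenvalue_def)
    then have "quadratic_form {..<?k} (quotient_kernel a P) y = m * square_norm {..<?k} y"
      by (intro quadratic_form_eigenfunction) (simp add: eigenfunction_def)
    then have "quadratic_form V a (lift P y) = m * square_norm V (lift P y)"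
      by (simp add: quadratic_form_lift[OF fin op] square_norm_lift[OF fin op])
    moreover have "\<exists>v\<in>V. lift P y v \<noteq> 0"
    proof -
      obtain p where p: "p < ?k" "y p \<noteq> 0" using y by (auto simp: eigenfunction_def)
      obtain v where v: "v \<in> P ! p" using ordered_partition_nonempty[OF op p(1)] by auto
      show ?thesis using lift_eq[OF op p(1) v, of y] p card[OF p(1)] sub[OF p(1)] v by force
    qed
    ultimately have "eigenfunction V a m (lift P y)"
      by (intro maximizer_eigenfunction[OF fin sym A]) simp_all
    then have x: "eigenfunction V a m (\<lambda>v. \<bar>lift P y v\<bar>)"
      by (intro abs_top_eigenfunction[OF fin sym nonneg A])
    define c where "c p = \<bar>y p / sqrt (card (P ! p))\<bar>" for p
    have c: "\<bar>lift P y v\<bar> = c p" if "p < ?k" "v \<in> P ! p" for p v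
      using lift_eq[OF op that] by (simp add: c_def)
    have pos: "0 < c p" if "p < ?k" for p
    proof -
      obtain v where v: "v \<in> P ! p" using ordered_partition_nonempty[OF op \<open>p < ?k\<close>] by auto
      have "v \<in> V" using v sub[OF that] by auto
      then have "0 < \<bar>lift P y v\<bar>"
        by (intro nonneg_eigenfunction_pos[OF fin sym nonneg irred x abs_ge_zero])
      then show ?thesis using c[OF that v] by simp
    qed
    have split: "(\<Sum>w\<in>P ! p. a v w) * c p = m * c p - (\<Sum>q\<in>{..<?k} - {p}. (\<Sum>w\<in>P ! q. a v w) * c q)"
      if p: "p < ?k" and v: "v \<in> P ! p" for p v
    proof -
      have "m * c p = (\<Sum>w\<in>V. a v w * \<bar>lift P y w\<bar>)"
        using x sub[OF p] v c[OF p v] by (auto simp: eigenfunction_def)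
      also have "\<dots> = (\<Sum>q<?k. \<Sum>w\<in>P ! q. a v w * \<bar>lift P y w\<bar>)"
        by (rule sum_over_classes[OF fin op])
      also have "\<dots> = (\<Sum>q<?k. (\<Sum>w\<in>P ! q. a v w) * c q)"
        by (simp add: c sum_distrib_right)
      also have "\<dots> = (\<Sum>w\<in>P ! p. a v w) * c p + (\<Sum>q\<in>{..<?k} - {p}. (\<Sum>w\<in>P ! q. a v w) * c q)"
        using p by (intro sum.remove) auto
      finally show ?thesis by simp
    qed
    show "\<forall>p<?k. \<forall>u\<in>P ! p. \<forall>v\<in>P ! p. (\<Sum>w\<in>P ! p. a u w) = (\<Sum>w\<in>P ! p. a v w)"
    proof (intro allI impI ballI)
      fix p u v assume p: "p < ?k" and u: "u \<in> P ! p" and v: "v \<in> P ! p"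
      have "(\<Sum>q\<in>{..<?k} - {p}. (\<Sum>w\<in>P ! q. a u w) * c q) = (\<Sum>q\<in>{..<?k} - {p}. (\<Sum>w\<in>P ! q. a v w) * c q)"
        using semi[OF p _ _ u v] by (intro sum.cong refl) simp
      then have "(\<Sum>w\<in>P ! p. a u w) * c p = (\<Sum>w\<in>P ! p. a v w) * c p"
        using split[OF p u] split[OF p v] by simp
      then show "(\<Sum>w\<in>P ! p. a u w) = (\<Sum>w\<in>P ! p. a v w)" using pos[OF p] by simp
    qed
  }
  assume regular: "\<forall>p<?k. \<forall>u\<in>P ! p. \<forall>v\<in>P ! p. (\<Sum>w\<in>P ! p. a u w) = (\<Sum>w\<in>P ! p. a v w)"
  have const: "(\<Sum>w\<in>P ! q. a u w) = (\<Sum>w\<in>P ! q. a v w)"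
    if "p < ?k" "q < ?k" "u \<in> P ! p" "v \<in> P ! p" for p q u v
    using regular semi[OF that(1,2)] that by (cases "p = q") blast+
  obtain f where "eigenfunction V a m f" using A by (auto simp: top_eigenvalue_def)
  then have "eigenfunction V a m (\<lambda>v. \<bar>f v\<bar>)"
    by (intro abs_top_eigenfunction[OF fin sym nonneg A])
  then have "eigenfunction {..<?k} (quotient_kernel a P) m
      (\<lambda>p. (\<Sum>v\<in>P ! p. \<bar>f v\<bar>) / sqrt (card (P ! p)))"
    by (intro class_sums_eigenfunction[OF fin op sym const]) simp_all
  then have "m \<le> l"
    by (rule eigenvalue_le_bound[rotated]) (use B in \<open>simp_all add: top_eigenvalue_def\<close>)
  with top_eigenvalue_quotient_le[OF fin op A B] show "m = l" by simp
qed

section \<open>Adjacency kernels of graphs\<close>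

definition adjacency :: "('a, 'b) pre_digraph \<Rightarrow> 'a \<Rightarrow> 'a \<Rightarrow> real" where
  "adjacency G u v = of_bool (u \<rightarrow>\<^bsub>G\<^esub> v)"

text \<open>
  Degrees count arcs, kernel sums count neighbours; the two agree because there are no parallel arcs.
\<close>

lemma sum_adjacency:
  assumes "Digraph.graph G" "finite Y"
  shows "(\<Sum>w\<in>Y. adjacency G v w) = card {e \<in> arcs G. tail G e = v \<and> head G e \<in> Y}"
proof -
  interpret Digraph.graph G by fact
  have "(\<Sum>w\<in>Y. adjacency G v w) = card {w \<in> Y. v \<rightarrow>\<^bsub>G\<^esub> w}"
    using assms(2) by (simp add: adjacency_def of_bool_def sum.If_cases Int_def)
  also have "{w \<in> Y. v \<rightarrow>\<^bsub>G\<^esub> w} = head G ` {e \<in> arcs G. tail G e = v \<and> head G e \<in> Y}"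
    by (auto simp: arcs_ends_conv)
  also have "card \<dots> = card {e \<in> arcs G. tail G e = v \<and> head G e \<in> Y}"
    by (intro card_image inj_onI) (auto intro: no_multi_arcs simp: arc_to_ends_def)
  finally show ?thesis .
qed

lemma out_degree_induce_subgraph:
  assumes "Digraph.graph G" "finite X" "v \<in> X"
  shows "real (out_degree (G \<restriction> X) v) = (\<Sum>w\<in>X. adjacency G v w)"
  unfolding sum_adjacency[OF assms(1,2)] out_degree_def out_arcs_def using assms(3)
  by (auto intro!: arg_cong[where f = card])

lemma bipartite_subgraph_commute: "bipartite_subgraph G X Y = bipartite_subgraph G Y X"
  by (auto simp: bipartite_subgraph_def)

lemma out_degree_bipartite_subgraph:
  assumes "Digraph.graph G" "finite Y" "v \<in> X" "X \<inter> Y = {}"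
  shows "real (out_degree (bipartite_subgraph G X Y) v) = (\<Sum>w\<in>Y. adjacency G v w)"
  unfolding sum_adjacency[OF assms(1,2)] out_degree_def out_arcs_def bipartite_subgraph_def
  using assms(3,4)
  by (auto intro!: arg_cong[where f = card])

text \<open>
  Semiequitability speaks of each unordered pair of classes once; the symmetry of
  \<open>bipartite_subgraph\<close> gives both orders.
\<close>

lemma semiequitable_class_sums:
  assumes G: "Digraph.graph G" and fin: "finite V" and op: "ordered_partition V P"
    and semi: "semiequitable G P"
    and p: "p < length P" and q: "q < length P" and "p \<noteq> q" and u: "u \<in> P ! p" and v: "v \<in> P ! p"
  shows "(\<Sum>w\<in>P ! q. adjacency G u w) = (\<Sum>w\<in>P ! q. adjacency G v w)"
proof -
  have disj: "P ! p \<inter> P ! q = {}"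
    using ordered_partition_disjoint[OF op p q \<open>p \<noteq> q\<close>] .
  have finq: "finite (P ! q)" using ordered_partition_subset[OF op q] fin finite_subset by blast
  have "out_degree (bipartite_subgraph G (P ! p) (P ! q)) u = out_degree (bipartite_subgraph G (P ! p) (P ! q)) v"
  proof (cases "p < q")
    case True
    then have "semiregular (P ! p) (P ! q) (bipartite_subgraph G (P ! p) (P ! q))"
      using semi q by (simp add: semiequitable_def)
    then show ?thesis using u v unfolding semiregular_def by blast
  next
    case False
    then have "q < p" using \<open>p \<noteq> q\<close> by simp
    then have "semiregular (P ! q) (P ! p) (bipartite_subgraph G (P ! q) (P ! p))"
      using semi p by (simp add: semiequitable_def)
    then show ?thesis
      using u v unfolding bipartite_subgraph_commute[of G "P ! p" "P ! q"] semiregular_def by blast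
  qed
  then show ?thesis
    using out_degree_bipartite_subgraph[OF G finq u disj] out_degree_bipartite_subgraph[OF G finq v disj]
    by simp
qed

lemma constant_on_iff: "(\<exists>d. \<forall>v\<in>X. f v = d) \<longleftrightarrow> (\<forall>u\<in>X. \<forall>v\<in>X. f u = f v)"
proof
  assume "\<forall>u\<in>X. \<forall>v\<in>X. f u = f v"
  then show "\<exists>d. \<forall>v\<in>X. f v = d" by (cases "X = {}") (simp, blast)
qed fastforce

lemma equitable_iff_class_sums:
  assumes G: "Digraph.graph G" and fin: "finite V" and op: "ordered_partition V P"
    and semi: "semiequitable G P"
  shows "equitable G P \<longleftrightarrow> (\<forall>p<length P. \<forall>u\<in>P ! p. \<forall>v\<in>P ! p.
    (\<Sum>w\<in>P ! p. adjacency G u w) = (\<Sum>w\<in>P ! p. adjacency G v w))"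
proof -
  have "regular_graph (G \<restriction> (P ! p)) \<longleftrightarrow> (\<forall>u\<in>P ! p. \<forall>v\<in>P ! p.
    (\<Sum>w\<in>P ! p. adjacency G u w) = (\<Sum>w\<in>P ! p. adjacency G v w))" if p: "p < length P" for p
  proof -
    have finp: "finite (P ! p)" using ordered_partition_subset[OF op p] fin finite_subset by blast
    have "regular_graph (G \<restriction> (P ! p)) \<longleftrightarrow> (\<forall>u\<in>P ! p. \<forall>v\<in>P ! p.
      out_degree (G \<restriction> (P ! p)) u = out_degree (G \<restriction> (P ! p)) v)"
      unfolding regular_graph_def using constant_on_iff by simp
    then show ?thesis
      by (simp add: out_degree_induce_subgraph[OF G finp, symmetric])
  qed
  then show ?thesis using semi by (simp add: equitable_def)
qed

text \<open>
  In a symmetric digraph, connectedness yields a directed path from a vertex of \<open>S\<close> to any other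
  vertex, and a path cannot leave a closed set.
\<close>

lemma connected_irreducible:
  assumes G: "Digraph.graph G" and conn: "Digraph_Component.connected G"
    and S: "S \<subseteq> verts G" "S \<noteq> {}"
    and closed: "\<And>u v. u \<in> S \<Longrightarrow> v \<in> verts G \<Longrightarrow> 0 < adjacency G u v \<Longrightarrow> v \<in> S"
  shows "S = verts G"
proof
  interpret Digraph.graph G by fact
  have sc: "strongly_connected G"
    using symmetric_connected_imp_strongly_connected[OF sym_arcs conn] .
  obtain u where u: "u \<in> S" using S by auto
  show "verts G \<subseteq> S"
  proof
    fix v assume "v \<in> verts G"
    then have "u \<rightarrow>\<^sup>*\<^bsub>G\<^esub> v" using sc u S by (auto simp: strongly_connected_def)
    then show "v \<in> S"
      unfolding reachable_def
      by (induction rule: rtrancl_on_induct) (auto simp: u adjacency_def intro: closed)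
  qed
qed (rule S)

theorem corollary10:
  fixes G :: "(nat, 'b) pre_digraph" and n :: nat and P :: "nat set list"
  assumes "Digraph.graph G"
    and "verts G = {1..n}"
    and "Digraph_Component.connected G"
    and "ordered_partition {1..n} P"
    and "semiequitable G P"
  shows "mu1 (adjacency_matrix n G) = mu1 (quotient_matrix (adjacency_matrix n G) P)
           \<longleftrightarrow> equitable G P"
proof -
  interpret Digraph.graph G by fact
  let ?V = "{1..n}" and ?k = "length P" and ?a = "adjacency G"
  have "verts G \<noteq> {}"
    using assms(3) by (auto simp: connected_def strongly_connected_def)
  then have ne: "?V \<noteq> {}" using assms(2) by simp
  have k: "{..<?k} \<noteq> {}"
    using ne ordered_partition_cover[OF assms(4)] by (metis equals0I lessThan_iff equals0D)
  have sym: "?a u v = ?a v u" for u v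
    using arcs_ends_symmetric[OF sym_arcs] by (auto simp: adjacency_def)
  obtain m where m: "top_eigenvalue ?V ?a m"
    using top_eigenvalue_exists[OF _ ne, of ?a] sym by auto
  obtain l where l: "top_eigenvalue {..<?k} (quotient_kernel ?a P) l"
    using top_eigenvalue_exists[OF _ k, of "quotient_kernel ?a P"]
      quotient_kernel_sym[OF assms(4) sym] by auto
  have "mu1 (adjacency_matrix n G) = m"
  proof (rule mu1_eq_top_eigenvalue[OF _ _ m])
    show "bij_betw Suc {..<n} {1..n}" 
      by (auto simp: bij_betw_def image_Suc_lessThan)
    show "adjacency_matrix n G = mat n n (\<lambda>(i, j). complex_of_real (?a (Suc i) (Suc j)))"
      by (auto simp: adjacency_matrix_def adjacency_def)
  qed
  moreover have "mu1 (quotient_matrix (adjacency_matrix n G) P) = l"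
  proof (rule mu1_eq_top_eigenvalue[OF _ _ l])
    show "bij_betw id {..<?k} {..<?k}" by simp
    have "(\<Sum>i\<in>P ! p. \<Sum>j\<in>P ! q. adjacency_matrix n G $$ (i - 1, j - 1))
      = complex_of_real (\<Sum>i\<in>P ! p. \<Sum>j\<in>P ! q. ?a i j)" if "p < ?k" "q < ?k" for p q
    proof -
      have "adjacency_matrix n G $$ (i - 1, j - 1) = complex_of_real (?a i j)" 
        if "i \<in> {1..n}" "j \<in> {1..n}" for i j
        using that by (auto simp: adjacency_matrix_def adjacency_def)
      then show ?thesis
        using ordered_partition_subset[OF assms(4)] that unfolding of_real_sum
        by (intro sum.cong refl) blast
    qed
    then show "quotient_matrix (adjacency_matrix n G) P =
      mat ?k ?k (\<lambda>(p, q). complex_of_real (quotient_kernel ?a P (id p) (id q)))"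
      unfolding quotient_matrix_def
      by (intro eq_matI) (auto simp: quotient_kernel_def real_sqrt_mult)
  qed
  moreover have "m = l \<longleftrightarrow> (\<forall>p<?k. \<forall>u\<in>P ! p. \<forall>v\<in>P ! p. (\<Sum>w\<in>P ! p. ?a u w) = (\<Sum>w\<in>P ! p. ?a v w))"
  proof (rule top_eigenvalue_quotient_eq_iff[OF _ assms(4) sym _ _ _ m l])
    show "S = ?V" if "S \<subseteq> ?V" "S \<noteq> {}"
      "\<And>u v. u \<in> S \<Longrightarrow> v \<in> ?V \<Longrightarrow> 0 < ?a u v \<Longrightarrow> v \<in> S" for S
      using connected_irreducible[OF assms(1,3), of S] that by (simp add: assms(2))
    show "(\<Sum>w\<in>P ! q. ?a u w) = (\<Sum>w\<in>P ! q. ?a v w)"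
      if "p < ?k" "q < ?k" "p \<noteq> q" "u \<in> P ! p" "v \<in> P ! p" for p q u v
      using semiequitable_class_sums[OF assms(1) _ assms(4,5) that] by simp
  qed (auto simp: adjacency_def)
  ultimately show ?thesis
    using equitable_iff_class_sums[OF assms(1) _ assms(4,5)] by simp
qed

end
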